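(* Let $k\ge 4$ and $n>2k$ be integers. If $k\equiv 2$ or $3\pmod 5$ and $n\equiv 0\pmod 5$, then $$\gamma_I(P(n,k))=\frac{4n}{5}.$$ Otherwise, $$\frac{4n}{5}\le \gamma_I(P(n,k))\le \frac{4(n-k)}{5}\cdot\frac{3k+2}{3k+1}+\frac{4k+6}{3}.$$
   Context: $P(n,k)$ (with $n\ge 3$, $1\le k<n/2$) denotes the generalized Petersen graph: the 3-regular simple graph on the $2n$ vertices $v_0,v_1,\dots,v_{2n-1}$ (subscripts read modulo $2n$) with edges $v_{2i}v_{2i+2}$, $v_{2i}v_{2i+1}$ and $v_{2i+1}v_{2i+1+2k}$ for $0\le i\le n-1$. For a graph $G=(V,E)$, an Italian dominating function (IDF) of $G$ is a function $f:V\to\{0,1,2\}$ such that every $v\in V$ with $f(v)=0$ satisfies $\sum_{u\in N(v)}f(u)\ge 2$, where $N(v)$ is the open neighborhood of $v$. Its weight is $w(f)=\sum_{v\in V}f(v)$, and the Italian domination number is $\gamma_I(G)=\min_f w(f)$ over all IDFs $f$ of $G$. *)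

theory Defs
  imports Complex_Main "HOL-Number_Theory.Cong" "Graph_Theory.Pair_Digraph"
begin

text \<open>
  As in the library, an undirected simple graph is a finite symmetric loop-free digraph
  without parallel arcs (locale \<open>pair_graph\<close>): each edge is present as two arcs.
  The vertex \<open>v\<^sub>j\<close> of the generalized Petersen graph is the number \<open>j < 2 * n\<close>;
  even numbers form the outer cycle, odd numbers the inner rim.
\<close>

definition gen_petersen :: "nat \<Rightarrow> nat \<Rightarrow> nat pair_pre_digraph" where
  "gen_petersen n k =
    (let E = (\<Union>i<n. {(2 * i, (2 * i + 2) mod (2 * n)),
                      (2 * i, 2 * i + 1),
                      (2 * i + 1, (2 * i + 1 + 2 * k) mod (2 * n))})
     in \<lparr> pverts = {..<2 * n}, parcs = E \<union> E\<inverse> \<rparr>)"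

definition open_nbhd :: "'a pair_pre_digraph \<Rightarrow> 'a \<Rightarrow> 'a set" where
  "open_nbhd G v = {u. (v, u) \<in> parcs G}"

text \<open>Values of \<open>f\<close> outside the vertex set are irrelevant in the following definitions.\<close>

definition italian_dominating :: "'a pair_pre_digraph \<Rightarrow> ('a \<Rightarrow> nat) \<Rightarrow> bool" where
  "italian_dominating G f \<longleftrightarrow>
     (\<forall>v\<in>pverts G. f v \<in> {0, 1, 2}) \<and>
     (\<forall>v\<in>pverts G. f v = 0 \<longrightarrow> (\<Sum>u\<in>open_nbhd G v. f u) \<ge> 2)"

definition weight :: "'a pair_pre_digraph \<Rightarrow> ('a \<Rightarrow> nat) \<Rightarrow> nat" where
  "weight G f = (\<Sum>v\<in>pverts G. f v)"

definition italian_domination_number :: "'a pair_pre_digraph \<Rightarrow> nat" where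
  "italian_domination_number G = (LEAST w. \<exists>f. italian_dominating G f \<and> weight G f = w)"

text \<open>The minimum is attained, since the constant function 2 is always Italian dominating.\<close>

lemma italian_dominating_const_2: "italian_dominating G (\<lambda>_. 2)"
  by (simp add: italian_dominating_def)

lemma italian_domination_number_attained:
  "\<exists>f. italian_dominating G f \<and> weight G f = italian_domination_number G"
  unfolding italian_domination_number_def
  by (rule LeastI_ex) (use italian_dominating_const_2 in blast)

lemma italian_domination_number_le:
  "italian_dominating G f \<Longrightarrow> italian_domination_number G \<le> weight G f"
  unfolding italian_domination_number_def by (rule Least_le) blast

lemma pair_graph_gen_petersen:
  assumes "n \<ge> 3" "1 \<le> k" "2 * k < n"
  shows "pair_graph (gen_petersen n k)"
proof -
  have neq: "(2 * i + 2) mod (2 * n) \<noteq> 2 * i \<and> (2 * i + 1 + 2 * k) mod (2 * n) \<noteq> 2 * i + 1"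
    if "i < n" for i
    using that assms by (auto simp: mod_if)
  show ?thesis
  proof unfold_locales
    fix e assume e: "e \<in> parcs (gen_petersen n k)"
    show "fst e \<in> pverts (gen_petersen n k)" "snd e \<in> pverts (gen_petersen n k)"
      using e assms by (auto simp: gen_petersen_def Let_def)
    show "fst e \<noteq> snd e"
      using e neq by (auto simp: gen_petersen_def Let_def) (metis neq)+
  next
    show "finite (pverts (gen_petersen n k))" "finite (parcs (gen_petersen n k))"
      by (auto simp: gen_petersen_def Let_def)
    show "symmetric (with_proj (gen_petersen n k))"
      by (auto simp: gen_petersen_def Let_def symmetric_def sym_def)
  qed
qed

end

theory Submission
  imports Defs "HOL-Library.Periodic_Fun"
begin

text \<open>
  The lower bound is a double count: in an \<open>r\<close>-regular graph every vertex satisfies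
  \<open>2 \<le> 2 * f v + (\<Sum>u\<in>N(v). f u)\<close>, whether or not \<open>f v = 0\<close>, and summing over all vertices
  gives \<open>2 * |V| \<le> (r + 2) * w(f)\<close> (lemma \<open>regular_italian_dominating_weight_ge\<close>).

  For the upper bound unroll \<open>P(n, k)\<close> to an infinite helix: an outer and an inner vertex for every
  integer \<open>i\<close>, outer vertices joined to \<open>i \<plusminus> 1\<close>, inner vertices to \<open>i \<plusminus> k\<close>. Reading the integers in
  rows of length \<open>k\<close>, outer edges run along rows and inner edges along columns. Tightness in
  the double count leads to the word in which an integer of phase \<open>t\<close> carries 1 on the outer vertex
  if \<open>t \<equiv> \<plusminus>1\<close>, on the inner vertex if \<open>t \<equiv> \<plusminus>2\<close>, and nowhere if \<open>t \<equiv> 0\<close> modulo 5. The outer vertices are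
  satisfied when the phase changes by \<open>\<plusminus>1\<close> along a row, the inner ones when it changes by
  \<open>\<plusminus>2\<close> along a column. For \<open>k \<equiv> 2, 3\<close> the phase \<open>t = i\<close> does both, which attains the lower bound
  whenever the period 5 divides \<open>n\<close>.

  For the other residues the phase has to jump between the rows, and jumps can be chosen such that one
  additional vertex repairs all damage in a long period: 5 rows of length \<open>k\<close> for
  \<open>k \<equiv> 0, 4\<close> (lemma \<open>helix_dominating_5k\<close>), and \<open>3 * k + 1\<close> consecutive integers for \<open>k \<equiv> 1\<close>
  (lemma \<open>helix_dominating_3k_plus_1\<close>). The second density is exactly
  \<open>4 / 5 * (3 * k + 2) / (3 * k + 1)\<close>, and the first one is smaller.

  The period need not divide \<open>n\<close>. Some window of \<open>n - k\<close> integers has at most the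
  average weight (lemma \<open>ex_light_window\<close>), and the remaining \<open>k\<close> integers form a single row that
  closes up any window: all its inner vertices get 1, so that no inner vertex of the
  window sees less than it did on the helix, and every third outer vertex gets 1
  (lemma \<open>italian_domination_number_le_window\<close>). This row costs at most \<open>(4 * k + 5) / 3\<close>.
\<close>

section \<open>Sums over blocks\<close>

lemma sum_lessThan_add: "(\<Sum>i<m + n. f i) = (\<Sum>i<m. f i) + (\<Sum>i<n. f (m + i))"
  for f :: "nat \<Rightarrow> 'a::comm_monoid_add"
  by (induction n) (simp_all add: add.assoc)

lemma sum_blocks: "(\<Sum>i<q * k. f i) = (\<Sum>j<q. \<Sum>x<k. f (j * k + x))"
  for f :: "nat \<Rightarrow> 'a::comm_monoid_add"
  by (induction q) (simp_all add: add.commute[of k] sum_lessThan_add)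

section \<open>Neighbourhoods and the lower bound\<close>

text \<open>
  A vertex with \<open>f v = 0\<close> contributes at least 2 through its neighbours, any other one through
  \<open>2 * f v\<close>. In the sum of these contributions each value \<open>f u\<close> is counted
  twice for \<open>u\<close> itself and once for each of its \<open>r\<close> neighbours.
\<close>

lemma regular_italian_dominating_weight_ge:
  assumes "pair_graph G" "italian_dominating G f"
    and regular: "\<And>v. v \<in> pverts G \<Longrightarrow> card (open_nbhd G v) = r"
  shows "2 * card (pverts G) \<le> (r + 2) * weight G f"
proof -
  interpret pair_graph G by fact
  have nbhd_eq: "open_nbhd G v = {u \<in> pverts G. (v, u) \<in> parcs G}" for v
    using in_arcsD2 by (auto simp: open_nbhd_def)
  have sym: "(v, u) \<in> parcs G \<longleftrightarrow> (u, v) \<in> parcs G" for u v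
    using arcs_symmetric by blast
  have "2 \<le> 2 * f v + (\<Sum>u\<in>open_nbhd G v. f u)" if "v \<in> pverts G" for v
    using assms(2) that by (cases "f v = 0") (auto simp: italian_dominating_def)
  then have "2 * card (pverts G) \<le> (\<Sum>v\<in>pverts G. 2 * f v + (\<Sum>u\<in>open_nbhd G v. f u))"
    using sum_mono[of "pverts G" "\<lambda>_. 2::nat"] by (simp add: mult.commute)
  also have "\<dots> = 2 * weight G f + (\<Sum>v\<in>pverts G. \<Sum>u | u \<in> pverts G \<and> (v, u) \<in> parcs G. f u)"
    by (simp add: sum.distrib weight_def nbhd_eq sum_distrib_left)
  also have "(\<Sum>v\<in>pverts G. \<Sum>u | u \<in> pverts G \<and> (v, u) \<in> parcs G. f u)
      = (\<Sum>u\<in>pverts G. \<Sum>v | v \<in> pverts G \<and> (v, u) \<in> parcs G. f u)"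
    by (rule sum.swap_restrict) auto
  also have "\<dots> = (\<Sum>u\<in>pverts G. card (open_nbhd G u) * f u)"
    by (simp add: nbhd_eq sym)
  also have "\<dots> = r * weight G f"
    by (simp add: regular weight_def sum_distrib_left)
  finally show ?thesis by (simp add: algebra_simps)
qed

lemma open_nbhd_gen_petersen:
  assumes "2 * k < n" "i < n"
  shows "open_nbhd (gen_petersen n k) (2 * i)
           = {2 * ((i + (n - 1)) mod n), 2 * ((i + 1) mod n), 2 * i + 1}"
    and "open_nbhd (gen_petersen n k) (2 * i + 1)
           = {2 * ((i + (n - k)) mod n) + 1, 2 * ((i + k) mod n) + 1, 2 * i}"
proof -
  have even_step: "(2 * j + 2) mod (2 * n) = 2 * ((j + 1) mod n)" if "j < n" for j
    using mult_mod_right[of 2 "j + 1" n] by simp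
  have odd_step: "(2 * j + 1 + 2 * k) mod (2 * n) = 2 * ((j + k) mod n) + 1" if "j < n" for j
    using that assms by (auto simp: mod_if)
  have pred: "(j + m) mod n = i \<longleftrightarrow> j = (i + (n - m)) mod n" if "j < n" "m \<le> n" for j m
    using that assms by (auto simp: mod_if split: if_splits)
  have arcs: "(\<Union>i<n. {(2 * i, (2 * i + 2) mod (2 * n)), (2 * i, 2 * i + 1),
                      (2 * i + 1, (2 * i + 1 + 2 * k) mod (2 * n))})
      = (\<Union>j<n. {(2 * j, 2 * ((j + 1) mod n)), (2 * j, 2 * j + 1),
                (2 * j + 1, 2 * ((j + k) mod n) + 1)})"
    by (rule SUP_cong) (simp_all only: lessThan_iff even_step odd_step)
  have E: "(v, u) \<in> parcs (gen_petersen n k) \<longleftrightarrow>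
     (\<exists>j<n. (v, u) \<in> {(2*j, 2 * ((j + 1) mod n)), (2*j, 2*j+1), (2*j+1, 2*((j+k) mod n)+1)} \<or>
            (u, v) \<in> {(2*j, 2 * ((j + 1) mod n)), (2*j, 2*j+1), (2*j+1, 2*((j+k) mod n)+1)})" for u v
    unfolding gen_petersen_def Let_def arcs by auto
  have parity: "2 * a \<noteq> Suc (2 * b)" "Suc (2 * b) \<noteq> 2 * a" for a b :: nat by presburger+
  have n: "n > 0" "1 \<le> n" "k \<le> n" using assms by auto
  have "(2 * i, u) \<in> parcs (gen_petersen n k) \<longleftrightarrow>
      u = 2 * ((i + 1) mod n) \<or> u = 2 * i + 1 \<or> (\<exists>j<n. u = 2 * j \<and> (j + 1) mod n = i)" for u
    unfolding E using assms by (auto simp: parity)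
  then show "open_nbhd (gen_petersen n k) (2 * i)
           = {2 * ((i + (n - 1)) mod n), 2 * ((i + 1) mod n), 2 * i + 1}"
    unfolding open_nbhd_def using n by (auto simp only: pred cong: conj_cong) simp_all
  have "(2 * i + 1, u) \<in> parcs (gen_petersen n k) \<longleftrightarrow>
      u = 2 * ((i + k) mod n) + 1 \<or> u = 2 * i \<or> (\<exists>j<n. u = 2 * j + 1 \<and> (j + k) mod n = i)" for u
    unfolding E using assms by (auto simp: parity)
  then show "open_nbhd (gen_petersen n k) (2 * i + 1)
           = {2 * ((i + (n - k)) mod n) + 1, 2 * ((i + k) mod n) + 1, 2 * i}"
    unfolding open_nbhd_def using n by (auto simp only: pred cong: conj_cong) simp_all
qed

text \<open>
  Needed for both rims; the outer one is the case \<open>k = 1\<close>.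
\<close>

lemma gen_petersen_neighbours_distinct:
  assumes "1 \<le> k" "2 * k < n" "i < (n::nat)"
  shows "(i + (n - k)) mod n \<noteq> (i + k) mod n"
  using assms by (auto simp: mod_if)

lemma open_nbhd_sums:
  assumes "1 \<le> k" "2 * k < n" "i < n"
  shows "(\<Sum>u\<in>open_nbhd (gen_petersen n k) (2 * i). f u)
      = f (2 * ((i + (n - 1)) mod n)) + f (2 * ((i + 1) mod n)) + f (2 * i + 1)"
    and "(\<Sum>u\<in>open_nbhd (gen_petersen n k) (2 * i + 1). f u)
      = f (2 * ((i + (n - k)) mod n) + 1) + f (2 * ((i + k) mod n) + 1) + f (2 * i)"
proof -
  have parity: "2 * a \<noteq> Suc (2 * b)" "Suc (2 * b) \<noteq> 2 * a" for a b :: nat by presburger+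
  have "(i + (n - 1)) mod n \<noteq> (i + 1) mod n"
    by (rule gen_petersen_neighbours_distinct) (use assms in auto)
  then show "(\<Sum>u\<in>open_nbhd (gen_petersen n k) (2 * i). f u)
      = f (2 * ((i + (n - 1)) mod n)) + f (2 * ((i + 1) mod n)) + f (2 * i + 1)"
    unfolding open_nbhd_gen_petersen[OF assms(2,3)] using parity by (simp add: add.assoc)
  have "(i + (n - k)) mod n \<noteq> (i + k) mod n"
    by (rule gen_petersen_neighbours_distinct) (use assms in auto)
  then show "(\<Sum>u\<in>open_nbhd (gen_petersen n k) (2 * i + 1). f u)
      = f (2 * ((i + (n - k)) mod n) + 1) + f (2 * ((i + k) mod n) + 1) + f (2 * i)"
    unfolding open_nbhd_gen_petersen[OF assms(2,3)] using parity by (simp add: add.assoc)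
qed

lemma verts_gen_petersen_cases:
  assumes "v \<in> pverts (gen_petersen n k)"
  obtains i where "i < n" "v = 2 * i" | i where "i < n" "v = 2 * i + 1"
proof -
  have "v < 2 * n" using assms by (simp add: gen_petersen_def Let_def)
  then have "v div 2 < n" "v = 2 * (v div 2) \<or> v = 2 * (v div 2) + 1" by presburger+
  then show thesis using that by blast
qed

lemma weight_gen_petersen: "weight (gen_petersen n k) f = (\<Sum>i<n. f (2 * i) + f (2 * i + 1))"
proof -
  have "(\<Sum>v<2 * n. f v) = (\<Sum>i<n. f (2 * i) + f (2 * i + 1))"
    by (induction n) (simp_all add: add.assoc)
  then show ?thesis by (simp add: weight_def gen_petersen_def Let_def)
qed

lemma italian_domination_number_gen_petersen_ge:
  assumes "1 \<le> k" "2 * k < n"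
  shows "4 * n \<le> 5 * italian_domination_number (gen_petersen n k)"
proof -
  let ?G = "gen_petersen n k"
  obtain f where f: "italian_dominating ?G f" "weight ?G f = italian_domination_number ?G"
    using italian_domination_number_attained by blast
  have "card (open_nbhd ?G v) = 3" if v: "v \<in> pverts ?G" for v
    using v
  proof (cases rule: verts_gen_petersen_cases)
    case (1 i)
    then show ?thesis using open_nbhd_sums(1)[OF assms, of i "\<lambda>_. 1 :: nat"] by simp
  next
    case (2 i)
    then show ?thesis using open_nbhd_sums(2)[OF assms, of i "\<lambda>_. 1 :: nat"] by simp
  qed
  then have "2 * card (pverts ?G) \<le> (3 + 2) * weight ?G f"
    using assms f by (intro regular_italian_dominating_weight_ge pair_graph_gen_petersen) auto
  then show ?thesis using f by (simp add: gen_petersen_def Let_def)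
qed

section \<open>Labellings of the infinite helix\<close>

text \<open>
  The functions \<open>out\<close> and \<open>inn\<close> label the outer and the inner vertices of the infinite
  helix, from which \<open>P(n, k)\<close> arises by reading the integers modulo \<open>n\<close>. Only labels 0 and 1 are admitted: then replacing any
  vertex by one with label 1 cannot harm its neighbours, and this is how windows are closed up.
\<close>

definition helix_dominating :: "int \<Rightarrow> (int \<Rightarrow> nat) \<Rightarrow> (int \<Rightarrow> nat) \<Rightarrow> bool" where
  "helix_dominating k out inn \<longleftrightarrow>
     (\<forall>i. out i \<le> 1 \<and> inn i \<le> 1 \<and>
          (out i = 0 \<longrightarrow> 2 \<le> out (i - 1) + out (i + 1) + inn i) \<and>
          (inn i = 0 \<longrightarrow> 2 \<le> inn (i - k) + inn (i + k) + out i))"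

lemma italian_domination_number_le_helix:
  assumes k: "1 \<le> k" "2 * k < n"
    and dom: "helix_dominating (int k) out inn"
    and period: "\<And>i. out (i + int n) = out i" "\<And>i. inn (i + int n) = inn i"
  shows "italian_domination_number (gen_petersen n k) \<le> (\<Sum>i<n. out (int i) + inn (int i))"
proof -
  let ?G = "gen_petersen n k"
  define f where "f v = (if even v then out (int (v div 2)) else inn (int (v div 2)))" for v
  have f_simps: "f (2 * i) = out (int i)" "f (2 * i + 1) = inn (int i)" for i
    by (simp_all add: f_def)
  interpret out: periodic_fun_simple out "int n" by standard (rule period)
  interpret inn: periodic_fun_simple inn "int n" by standard (rule period)
  have out_mod: "out (j mod int n) = out j" for j
    using out.minus_of_int[of j "j div int n"] by (simp add: minus_div_mult_eq_mod)
  have inn_mod: "inn (j mod int n) = inn j" for j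
    using inn.minus_of_int[of j "j div int n"] by (simp add: minus_div_mult_eq_mod)
  have neighbours: "out (int ((i + (n - 1)) mod n)) = out (int i - 1)"
       "out (int ((i + 1) mod n)) = out (int i + 1)"
       "inn (int ((i + (n - k)) mod n)) = inn (int i - int k)"
       "inn (int ((i + k) mod n)) = inn (int i + int k)" if "i < n" for i
    using k out.plus_1[of "int i - 1"] inn.plus_1[of "int i - int k"]
    by (simp_all add: zmod_int out_mod inn_mod algebra_simps of_nat_diff)
  have "italian_dominating ?G f"
    unfolding italian_dominating_def
  proof (intro conjI ballI impI)
    fix v assume "v \<in> pverts ?G"
    have "f v \<le> 1" using dom by (auto simp: f_def helix_dominating_def)
    then show "f v \<in> {0, 1, 2}" by auto
  next
    fix v assume v: "v \<in> pverts ?G" and f0: "f v = 0"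
    from v show "2 \<le> (\<Sum>u\<in>open_nbhd ?G v. f u)"
    proof (cases rule: verts_gen_petersen_cases)
      case (1 i)
      then show ?thesis using dom f0
        by (simp only: open_nbhd_sums[OF k] f_simps neighbours helix_dominating_def)
    next
      case (2 i)
      then show ?thesis using dom f0
        by (simp only: open_nbhd_sums[OF k] f_simps neighbours helix_dominating_def)
    qed
  qed
  from italian_domination_number_le[OF this] show ?thesis
    by (simp only: weight_gen_petersen f_simps)
qed

section \<open>Closing a window of the helix\<close>

text \<open>
  The closing row consists of the last \<open>k\<close> integers modulo \<open>n\<close>. Its inner vertices all have label 1, so
  the outer ones need one further neighbour, which every third label 1 provides. If a column neighbour
  of a window vertex is not in the window, it lies in the closing row and has label 1 there;
  the two ends of the closing row have outer label 1 as well, for the sake of the first and the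
  last outer vertex of the window.
\<close>

lemma italian_domination_number_le_window:
  assumes k: "1 \<le> k" "2 * k < n" and dom: "helix_dominating (int k) out inn"
  shows "3 * italian_domination_number (gen_petersen n k)
           \<le> 3 * (\<Sum>i<n - k. out (c + int i) + inn (c + int i)) + 4 * k + 5"
proof -
  define L where "L = int n - int k"
  have L: "int k < L" "L < int n" "1 < L" using k by (auto simp: L_def)
  define seam where "seam p \<longleftrightarrow> p mod 3 = 0 \<or> p = int k - 1" for p
  define out' where "out' i = (let r = i mod int n in
     if r < L then out (c + r) else of_bool (seam (r - L)))" for i
  define inn' where "inn' i = (let r = i mod int n in if r < L then inn (c + r) else 1)" for i
  have outD: "out i \<le> 1" "out i = 0 \<Longrightarrow> 2 \<le> out (i - 1) + out (i + 1) + inn i"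
   and innD: "inn i \<le> 1" "inn i = 0 \<Longrightarrow> 2 \<le> inn (i - int k) + inn (i + int k) + out i" for i
    using dom by (auto simp: helix_dominating_def)
  have "helix_dominating (int k) out' inn'"
    unfolding helix_dominating_def
  proof (intro allI conjI impI)
    fix i
    show "out' i \<le> 1" "inn' i \<le> 1"
      by (simp_all add: out'_def inn'_def Let_def outD innD del: One_nat_def)
    define r where "r = i mod int n"
    have r: "0 \<le> r" "r < int n" using k by (auto simp: r_def)
    have shift: "(i + d) mod int n =
       (if r + d < 0 then r + d + int n else if r + d < int n then r + d else r + d - int n)"
      if "\<bar>d\<bar> < int n" for d
    proof -
      have "(i + d) mod int n = (r + d) mod int n" by (simp add: r_def mod_add_left_eq)
      also have "\<dots> = (r + d + int n) mod int n" "\<dots> = (r + d - int n) mod int n" by simp_all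
      ultimately show ?thesis using r that by (smt (verit) mod_pos_pos_trivial)
    qed
    have step: "(i + 1) mod int n = (if r = int n - 1 then 0 else r + 1)"
       "(i - 1) mod int n = (if r = 0 then int n - 1 else r - 1)"
       "(i + int k) mod int n = (if r < L then r + int k else r - L)"
       "(i - int k) mod int n = (if r < int k then r + L else r - int k)"
      using r k shift[of 1] shift[of "-1"] shift[of "int k"] shift[of "- int k"]
      by (auto simp: L_def)
    note defs = out'_def inn'_def Let_def step r_def[symmetric]
    show "2 \<le> out' (i - 1) + out' (i + 1) + inn' i" if z: "out' i = 0"
    proof (cases "r < L")
      case True
      have "seam 0" "seam (int k - 1)" by (auto simp: seam_def)
      then have "out' (i - 1) = (if r = 0 then 1 else out (c + r - 1))"
        and "out' (i + 1) = (if r = L - 1 then 1 else out (c + r + 1))"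
        unfolding defs using True r L by (auto simp: L_def algebra_simps)
      then have "out (c + r - 1) \<le> out' (i - 1)" "out (c + r + 1) \<le> out' (i + 1)"
        by (simp_all add: outD del: One_nat_def)
      moreover have "inn' i = inn (c + r)" "out (c + r) = 0" using True z by (auto simp: defs)
      ultimately show ?thesis using outD(2)[of "c + r"] by linarith
    next
      case False
      define p where "p = r - L"
      have p: "0 \<le> p" "p < int k" "\<not> seam p" "r = p + L"
        using z False r by (auto simp: p_def L_def out'_def Let_def r_def[symmetric])
      then have "inn' i = 1" "out' (i - 1) = of_bool (seam (p - 1))"
        "out' (i + 1) = of_bool (seam (p + 1))"
        using L unfolding defs by (auto simp: seam_def L_def)
      moreover have "seam (p - 1) \<or> seam (p + 1)"
        using p unfolding seam_def by presburger
      ultimately show ?thesis by auto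
    qed
    show "2 \<le> inn' (i - int k) + inn' (i + int k) + out' i" if z: "inn' i = 0"
    proof -
      have window: "r < L" using z by (auto simp: defs split: if_splits)
      then have "inn' (i - int k) = (if r < int k then 1 else inn (c + r - int k))"
        and "inn' (i + int k) = (if r < L - int k then inn (c + r + int k) else 1)"
        unfolding defs using r L by (auto simp: algebra_simps)
      then have "inn (c + r - int k) \<le> inn' (i - int k)" "inn (c + r + int k) \<le> inn' (i + int k)"
        by (simp_all add: innD del: One_nat_def)
      moreover have "out' i = out (c + r)" "inn (c + r) = 0" using window z by (auto simp: defs)
      ultimately show ?thesis using innD(2)[of "c + r"] by linarith
    qed
  qed
  then have le: "italian_domination_number (gen_petersen n k)
      \<le> (\<Sum>i<n. out' (int i) + inn' (int i))"
    by (rule italian_domination_number_le_helix[OF k]) (simp_all add: out'_def inn'_def)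
  have "(\<Sum>i<n. out' (int i) + inn' (int i))
     = (\<Sum>i<n - k. out' (int i) + inn' (int i))
       + (\<Sum>p<k. out' (int (n - k + p)) + inn' (int (n - k + p)))"
    using sum_lessThan_add[of "\<lambda>i. out' (int i) + inn' (int i)" "n - k" k] k by simp
  also have "(\<Sum>i<n - k. out' (int i) + inn' (int i))
     = (\<Sum>i<n - k. out (c + int i) + inn (c + int i))"
    by (rule sum.cong) (auto simp: out'_def inn'_def Let_def L_def)
  also have "(\<Sum>p<k. out' (int (n - k + p)) + inn' (int (n - k + p)))
     = (\<Sum>p<k. of_bool (seam (int p)) + 1)"
    using k by (intro sum.cong) (auto simp: out'_def inn'_def Let_def L_def of_nat_diff)
  also have "\<dots> \<le> (\<Sum>p<k. of_bool (p mod 3 = 0) + of_bool (p = k - 1) + 1)"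
  proof (intro sum_mono)
    fix p
    have "seam (int p) \<Longrightarrow> p mod 3 = 0 \<or> p = k - 1" using k unfolding seam_def by presburger
    then show "of_bool (seam (int p)) + 1 \<le> of_bool (p mod 3 = 0) + of_bool (p = k - 1) + (1::nat)"
      by auto
  qed
  also have "\<dots> = (\<Sum>p<k. of_bool (p mod 3 = 0)) + 1 + k"
    using k by (simp add: sum.distrib sum.delta of_bool_def[of "_ = k - 1"] del: One_nat_def sum_of_bool_eq)
  finally have "(\<Sum>i<n. out' (int i) + inn' (int i))
     \<le> (\<Sum>i<n - k. out (c + int i) + inn (c + int i)) + (\<Sum>p<k. of_bool (p mod 3 = 0)) + 1 + k"
    by simp
  moreover have count: "(\<Sum>p<k. of_bool (p mod 3 = 0)) = (k + 2) div 3" for k :: nat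
    by (induction k) (auto, presburger+)
  moreover have "3 * ((k + 2) div 3) \<le> k + 2" by simp
  ultimately show ?thesis using le count[of k] by linarith
qed

text \<open>
  Averaging over the \<open>N\<close> possible positions of the window: each residue modulo \<open>N\<close> is met by
  exactly \<open>L\<close> pairs of a position and an offset in the window.
\<close>

lemma ex_light_window:
  fixes h :: "int \<Rightarrow> nat"
  assumes "0 < N" and period: "\<And>i. h (i + int N) = h i"
  shows "\<exists>c. N * (\<Sum>i<L. h (c + int i)) \<le> L * (\<Sum>i<N. h (int i))"
proof (rule ccontr)
  assume "\<not> ?thesis"
  then have less: "L * (\<Sum>i<N. h (int i)) < N * (\<Sum>i<L. h (int c + int i))" for c
    by (meson not_le)
  have shift: "(\<Sum>c<N. h (int c + int i)) = (\<Sum>c<N. h (int c))" for i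
  proof (induction i)
    case (Suc i)
    let ?g = "\<lambda>c. h (int c + int i)"
    have "?g N = ?g 0" using period[of "int i"] by (simp add: add.commute)
    then have "(\<Sum>c<N. ?g (Suc c)) = (\<Sum>c<N. ?g c)"
      using sum.lessThan_Suc_shift[of ?g N] by simp
    then show ?case using Suc by (simp add: ac_simps)
  qed simp
  have "(\<Sum>c<N. L * (\<Sum>i<N. h (int i))) < (\<Sum>c<N. N * (\<Sum>i<L. h (int c + int i)))"
    using less assms(1) by (intro sum_strict_mono) auto
  also have "\<dots> = N * (\<Sum>i<L. \<Sum>c<N. h (int c + int i))"
    by (simp add: sum_distrib_left[symmetric] sum.swap[of _ "{..<L}"])
  finally show False by (simp add: shift)
qed

section \<open>The perfect word\<close>

text \<open>
  The residues with outer label 1 are \<open>\<plusminus>1\<close>, those with inner label 1 are \<open>\<plusminus>2\<close>. The word is thus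
  invariant under \<open>t \<mapsto> - t\<close>, so an outer vertex tolerates phases that rise or fall along its row.
\<close>

definition outer_word :: "int \<Rightarrow> nat" where
  "outer_word t = of_bool (t mod 5 = 1 \<or> t mod 5 = 4)"

definition inner_word :: "int \<Rightarrow> nat" where
  "inner_word t = of_bool (t mod 5 = 2 \<or> t mod 5 = 3)"

lemma word_cong:
  assumes "[s = t] (mod 5)"
  shows "outer_word s = outer_word t" "inner_word s = inner_word t"
  using assms by (simp_all add: outer_word_def inner_word_def cong_def)

lemma word_le_1: "outer_word t \<le> 1" "inner_word t \<le> 1"
  by (simp_all add: outer_word_def inner_word_def)

lemma mod_5_mem: "t mod 5 \<in> {0, 1, 2, 3, 4}" for t :: int
  by (simp only: insert_iff empty_iff) presburger

text \<open>
  These rules turn a statement about all integers into one about the five residues, which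
  evaluation settles.
\<close>

lemma word_mod:
  "outer_word (t mod 5) = outer_word t" "inner_word (t mod 5) = inner_word t"
  "outer_word (t mod 5 + d) = outer_word (t + d)" "inner_word (t mod 5 + d) = inner_word (t + d)"
  "outer_word (t mod 5 - d) = outer_word (t - d)" "inner_word (t mod 5 - d) = inner_word (t - d)"
  "inner_word (t + d mod 5) = inner_word (t + d)" "inner_word (t - d mod 5) = inner_word (t - d)"
  by (simp_all only: outer_word_def inner_word_def mod_add_left_eq mod_diff_left_eq
      mod_add_right_eq mod_diff_right_eq mod_mod_trivial)

lemma outer_word_dominated:
  assumes "outer_word t = 0"
  shows "2 \<le> outer_word (t - 1) + outer_word (t + 1) + inner_word t"
proof -
  have "\<forall>r\<in>{0, 1, 2, 3, 4}. outer_word r = 0 \<longrightarrow>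
      2 \<le> outer_word (r - 1) + outer_word (r + 1) + inner_word r"
    by (simp add: outer_word_def inner_word_def)
  from bspec[OF this mod_5_mem[of t]] show ?thesis
    using assms unfolding word_mod by blast
qed

text \<open>
  If the phase turns round at a vertex, both row neighbours have the same phase, \<open>t + 1\<close> or \<open>t - 1\<close>.
  The outer vertex is then short of 1 for a single residue only, \<open>t \<equiv> 2\<close> and \<open>t \<equiv> 3\<close> respectively.
\<close>

lemma outer_word_reflected:
  assumes "outer_word t = 0"
  shows "2 \<le> 2 * outer_word (t + 1) + inner_word t + of_bool (t mod 5 = 2)"
    and "2 \<le> 2 * outer_word (t - 1) + inner_word t + of_bool (t mod 5 = 3)"
proof -
  have "\<forall>r\<in>{0, 1, 2, 3, 4}. outer_word r = 0 \<longrightarrow>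
      2 \<le> 2 * outer_word (r + 1) + inner_word r + of_bool (r = 2) \<and>
      2 \<le> 2 * outer_word (r - 1) + inner_word r + of_bool (r = 3)"
    by (simp add: outer_word_def inner_word_def)
  from bspec[OF this mod_5_mem[of t]]
  show "2 \<le> 2 * outer_word (t + 1) + inner_word t + of_bool (t mod 5 = 2)"
    and "2 \<le> 2 * outer_word (t - 1) + inner_word t + of_bool (t mod 5 = 3)"
    using assms unfolding word_mod by blast+
qed

lemma inner_word_dominated:
  assumes "inner_word t = 0" "[d = 2] (mod 5) \<or> [d = 3] (mod 5)"
  shows "2 \<le> inner_word (t - d) + inner_word (t + d) + outer_word t"
proof -
  have all: "\<forall>r\<in>{0, 1, 2, 3, 4}. \<forall>e\<in>{2, 3}. inner_word r = 0 \<longrightarrow>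
      2 \<le> inner_word (r - e) + inner_word (r + e) + outer_word r"
    by (simp add: outer_word_def inner_word_def)
  have "d mod 5 \<in> {2, 3}" using assms(2) by (auto simp: cong_def)
  from bspec[OF bspec[OF all mod_5_mem[of t]] this] show ?thesis
    using assms(1) unfolding word_mod by blast
qed

abbreviation word_weight :: "int \<Rightarrow> nat" where
  "word_weight t \<equiv> outer_word t + inner_word t"

lemma word_weight_eq: "word_weight t = of_bool (t mod 5 \<noteq> 0)"
proof -
  have "\<forall>r\<in>{0, 1, 2, 3, 4}. word_weight r = of_bool (r mod 5 \<noteq> 0)"
    by (simp add: outer_word_def inner_word_def)
  from bspec[OF this mod_5_mem[of t]] show ?thesis unfolding word_mod mod_mod_trivial .
qed

lemma word_weight_5:
  "(\<Sum>i<5. word_weight (a + int i)) = 4"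
proof -
  have interval: "{..<5} = {0, 1, 2, 3, 4 :: nat}" by auto
  have "\<forall>r\<in>{0, 1, 2, 3, 4}. (\<Sum>i<5. word_weight (r + int i)) = 4"
    unfolding interval by (simp add: outer_word_def inner_word_def)
  from bspec[OF this mod_5_mem[of a]] show ?thesis unfolding word_mod .
qed

lemma word_weight_multiples_5:
  "(\<Sum>i<5 * m. word_weight (a + int i)) = 4 * m"
proof (induction m)
  case (Suc m)
  show ?case
    using Suc word_weight_5[of "a + 5 * int m"]
      sum_lessThan_add[of "\<lambda>i. word_weight (a + int i)" "5 * m" 5]
    by (simp add: algebra_simps)
qed simp

text \<open>
  With phase \<open>t = i\<close> a column step changes the phase by \<open>k\<close>, that is, by \<open>\<plusminus>2\<close>.
\<close>

lemma helix_dominating_word: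
  assumes "[k = 2] (mod 5) \<or> [k = 3] (mod 5)"
  shows "helix_dominating k outer_word inner_word"
  using assms by (auto simp: helix_dominating_def word_le_1 outer_word_dominated inner_word_dominated
      simp del: One_nat_def)

section \<open>Residues 0 and 4: one additional vertex in 5k columns\<close>

text \<open>
  Lowering the phase by 2 at each new row makes a column step change it by \<open>k - 2\<close>, which is
  \<open>\<plusminus>2\<close> modulo 5, so all inner vertices are satisfied. Across the end of a row the phase now falls by 1
  instead of rising by 1: it turns round at the last and at the first vertex of a row. By
  \<open>outer_word_reflected\<close> these outer vertices are short of 1 only if the last one has phase 3 and hence
  the next one, the first of the following row, has phase 2. They are adjacent, so giving label 1 to
  the former helps both.
\<close>

lemma helix_dominating_5k:
  fixes k :: int
  assumes k: "1 < k" "[k = 0] (mod 5) \<or> [k = 4] (mod 5)"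
  defines "t \<equiv> \<lambda>i. i - 2 * (i div k)"
  shows "helix_dominating k
    (\<lambda>i. outer_word (t i) + of_bool ((i + 1) mod k = 0 \<and> t i mod 5 = 3)) (\<lambda>i. inner_word (t i))"
    (is "helix_dominating k ?out ?inn")
  unfolding helix_dominating_def
proof (intro allI conjI impI)
  fix i
  have t_step: "t (i + 1) = (if (i + 1) mod k = 0 then t i - 1 else t i + 1)" for i
  proof -
    have "(i + 1) div k = (if (i + 1) mod k = 0 then i div k + 1 else i div k)"
    proof (cases "(i + 1) mod k = 0")
      case True
      then have "i + 1 = k * ((i + 1) div k)" by (metis add_0_right mult_div_mod_eq)
      then have "i = k * ((i + 1) div k - 1) + (k - 1)" by (simp add: algebra_simps)
      from int_div_pos_eq[OF this] show ?thesis using True k(1) by simp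
    next
      case False
      have "i + 1 = k * (i div k) + (i mod k + 1)" by (simp add: mult_div_mod_eq)
      moreover have "i mod k + 1 < k"
      proof -
        have "i mod k + 1 \<noteq> k" using False calculation by (metis mod_mult_self4 mod_self)
        then show ?thesis using k(1) pos_mod_bound[of k i] by linarith
      qed
      ultimately show ?thesis
        using int_div_pos_eq[of "i + 1" k "i div k" "i mod k + 1"] False k(1) by simp
    qed
    then show ?thesis by (simp add: t_def)
  qed
  have t_row: "t (i + k) = t i + (k - 2)" "t (i - k) = t i - (k - 2)"
    using k(1) div_add_self2[of k i] div_add_self2[of k "i - k"] by (simp_all add: t_def)
  have k2: "[k - 2 = 2] (mod 5) \<or> [k - 2 = 3] (mod 5)"
    using k(2) mod_diff_left_eq[of k 5 2] by (auto simp: cong_def)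
  show "?out i \<le> 1" "?inn i \<le> 1" by (auto simp: outer_word_def inner_word_def)
  show "2 \<le> ?inn (i - k) + ?inn (i + k) + ?out i" if "?inn i = 0"
    using inner_word_dominated[OF that k2] by (simp add: t_row)
  show "2 \<le> ?out (i - 1) + ?out (i + 1) + ?inn i" if "?out i = 0"
  proof -
    have zero: "outer_word (t i) = 0" "(i + 1) mod k = 0 \<Longrightarrow> t i mod 5 \<noteq> 3"
      using that by auto
    have pred: "t (i - 1) = (if i mod k = 0 then t i + 1 else t i - 1)"
      using t_step[of "i - 1"] by (auto split: if_splits)
    have not_both: "(i + 1) mod k \<noteq> 0" if "i mod k = 0"
      using that k(1) by (metis mod_add_left_eq add_0 mod_pos_pos_trivial zero_le_one zero_neq_one)
    consider (first) "i mod k = 0" | (last) "i mod k \<noteq> 0" "(i + 1) mod k = 0"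
      | (inside) "i mod k \<noteq> 0" "(i + 1) mod k \<noteq> 0" by blast
    then show ?thesis
    proof cases
      case first
      have "(t i + 1) mod 5 = 3" if "t i mod 5 = 2" using that by presburger
      with first show ?thesis
        using outer_word_reflected(1)[OF zero(1)] not_both[OF first]
        by (cases "t i mod 5 = 2") (auto simp: t_step pred)
    next
      case last
      then show ?thesis
        using outer_word_reflected(2)[OF zero(1)] zero(2) by (simp add: t_step pred)
    next
      case inside
      then show ?thesis
        using outer_word_dominated[OF zero(1)] by (simp add: t_step pred)
    qed
  qed
qed

text \<open>
  The five integers in one column of five successive rows run through all residues modulo 5, since
  \<open>k - 2\<close> is invertible. So each of the \<open>k\<close> columns has weight 4, and exactly one of the five row ends
  has phase 3 and receives the additional label.
\<close>

lemma weight_5k: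
  fixes k :: nat
  assumes k: "0 < k" "[k = 0] (mod 5) \<or> [k = 4] (mod 5)"
  defines "t \<equiv> \<lambda>i. i - 2 * (i div int k)"
  shows "(\<Sum>i<5 * k. outer_word (t (int i)) + of_bool ((int i + 1) mod int k = 0 \<and> t (int i) mod 5 = 3)
                    + inner_word (t (int i))) = 4 * k + 1"
proof -
  define e where "e = int k - 2"
  define w where "w s = word_weight s + of_bool (s mod 5 = 3)" for s
  define h where "h i = outer_word (t (int i)) + of_bool ((int i + 1) mod int k = 0 \<and> t (int i) mod 5 = 3)
                    + inner_word (t (int i))" for i
  have h_row: "h (q * k + x) = word_weight (int x + int q * e)
      + of_bool (x = k - 1 \<and> (int x + int q * e) mod 5 = 3)" if "x < k" for q x
  proof -
    have "int (q * k + x) div int k = int q"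
      using that by (intro int_div_pos_eq[where r = "int x"]) auto
    then have "t (int (q * k + x)) = int x + int q * e" by (simp add: t_def e_def algebra_simps)
    moreover have "(int (q * k + x) + 1) mod int k = 0 \<longleftrightarrow> x = k - 1"
    proof -
      have "(int (q * k + x) + 1) mod int k = (int x + 1) mod int k"
        by (metis add.assoc mod_mult_self3 of_nat_add of_nat_mult)
      also have "\<dots> = int ((x + 1) mod k)" by (simp add: zmod_int add.commute)
      finally show ?thesis using that by (auto simp: mod_Suc split: if_splits)
    qed
    ultimately show ?thesis unfolding h_def by simp
  qed
  have column: "word_weight y + word_weight (y + e) + word_weight (y + 2 * e) + word_weight (y + 3 * e)
      + word_weight (y + 4 * e) = 4"
    "of_bool (y mod 5 = 3) + of_bool ((y + e) mod 5 = 3) + of_bool ((y + 2 * e) mod 5 = 3)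
      + of_bool ((y + 3 * e) mod 5 = 3) + of_bool ((y + 4 * e) mod 5 = 3) = (1 :: nat)" for y
  proof -
    have e: "e mod 5 \<in> {2, 3}"
    proof -
      have "[int k = 0] (mod 5) \<or> [int k = 4] (mod 5)"
        using k(2) by (metis cong_int_iff of_nat_numeral of_nat_0)
      then show ?thesis
        using mod_diff_left_eq[of "int k" 5 2] by (auto simp: e_def cong_def)
    qed
    have shift: "(y mod 5 + e mod 5) mod 5 = (y + e) mod 5"
      "(y mod 5 + c * (e mod 5)) mod 5 = (y + c * e) mod 5" for c
      by (simp_all only: mod_add_eq, intro mod_add_cong) (simp_all only: mod_mult_right_eq mod_mod_trivial)
    have "\<forall>a\<in>{0, 1, 2, 3, 4 :: int}. \<forall>b\<in>{2, 3}.
       of_bool (a mod 5 \<noteq> 0) + of_bool ((a + b) mod 5 \<noteq> 0) + of_bool ((a + 2 * b) mod 5 \<noteq> 0)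
         + of_bool ((a + 3 * b) mod 5 \<noteq> 0) + of_bool ((a + 4 * b) mod 5 \<noteq> 0) = (4 :: nat) \<and>
       of_bool (a mod 5 = 3) + of_bool ((a + b) mod 5 = 3) + of_bool ((a + 2 * b) mod 5 = 3)
         + of_bool ((a + 3 * b) mod 5 = 3) + of_bool ((a + 4 * b) mod 5 = 3) = (1 :: nat)"
      by simp
    from bspec[OF bspec[OF this mod_5_mem[of y]] e]
    show "word_weight y + word_weight (y + e) + word_weight (y + 2 * e) + word_weight (y + 3 * e)
      + word_weight (y + 4 * e) = 4"
    "of_bool (y mod 5 = 3) + of_bool ((y + e) mod 5 = 3) + of_bool ((y + 2 * e) mod 5 = 3)
      + of_bool ((y + 3 * e) mod 5 = 3) + of_bool ((y + 4 * e) mod 5 = 3) = (1 :: nat)"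
      unfolding shift mod_mod_trivial word_weight_eq by blast+
  qed
  have "(\<Sum>i<5 * k. h i) = (\<Sum>q<5. \<Sum>x<k. h (q * k + x))"
    by (rule sum_blocks)
  also have "\<dots> = (\<Sum>x<k. \<Sum>q<5. h (q * k + x))"
    by (rule sum.swap)
  also have "\<dots> = (\<Sum>x<k. 4 + of_bool (x = k - 1))"
  proof (rule sum.cong[OF refl])
    fix x assume x: "x \<in> {..<k}"
    define b where "b \<longleftrightarrow> x = k - 1"
    have "(\<Sum>q<5. h (q * k + x)) = (\<Sum>q<5. word_weight (int x + int q * e)
        + of_bool (b \<and> (int x + int q * e) mod 5 = 3))"
      using x h_row[of x] by (intro sum.cong) (simp_all add: b_def)
    moreover have interval: "{..<5} = {0, 1, 2, 3, 4 :: nat}" by auto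
    ultimately show "(\<Sum>q<5. h (q * k + x)) = 4 + of_bool (x = k - 1)"
      unfolding b_def[symmetric] interval using column[of "int x"] by (cases b) simp_all
  qed
  also have "\<dots> = 4 * k + 1"
    using k(1) by (simp add: sum.distrib of_bool_def[of "_ = k - 1"] del: One_nat_def sum_of_bool_eq)
  finally show ?thesis by (simp add: h_def)
qed

section \<open>Residue 1: one additional vertex in 3k + 1 columns\<close>

text \<open>
  In a period of \<open>3 * k + 1\<close> integers let the phase rise by 3 instead of 1 on entering the integers
  \<open>k\<close>, \<open>2 * k\<close> and \<open>3 * k\<close>. A column step then changes it by \<open>k + 2 \<equiv> 3\<close> inside the period, and also across
  the end of the period, as \<open>k\<close> steps forward are \<open>2 * k + 1\<close> steps back there. The exception is the step
  from \<open>3 * k\<close> to \<open>k - 1\<close>, where the inner vertex of \<open>3 * k\<close> misses a label 1. The jumps at \<open>2 * k\<close> and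
  \<open>3 * k\<close> hurt no outer vertex, while the one at \<open>k\<close> leaves the outer vertex of \<open>k - 1\<close> (phase 0)
  without its right neighbour. The inner vertex of \<open>k - 1\<close> is adjacent to both deficient vertices,
  and giving it label 1 also settles its own deficit, caused by the same bad column step.
\<close>

lemma helix_dominating_3k_plus_1:
  fixes k :: int
  assumes k: "1 < k" "[k = 1] (mod 5)"
  defines "r \<equiv> \<lambda>i. i mod (3 * k + 1)"
  defines "t \<equiv> \<lambda>i. r i + 2 * (r i div k)"
  shows "helix_dominating k
    (\<lambda>i. outer_word (t i)) (\<lambda>i. inner_word (t i) + of_bool (r i = k - 1))"
    (is "helix_dominating k ?out ?inn")
  unfolding helix_dominating_def
proof (intro allI conjI impI)
  fix i
  obtain m where m: "k = 5 * m + 1"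
  proof -
    have "5 dvd k - 1" using k(2) by (simp add: cong_iff_dvd_diff)
    then obtain m where "k - 1 = 5 * m" by (rule dvdE)
    then show thesis by (intro that[of m]) simp
  qed
  have m_pos: "0 < m" using k(1) m by simp
  have word_5: "outer_word x = outer_word y" "inner_word x = inner_word y"
    if "x = y + 5 * c" for x y c
    using that by (auto intro!: word_cong simp: cong_iff_dvd_diff)
  have r_bounds: "0 \<le> r j" "r j \<le> 3 * k" for j
    using k(1) pos_mod_bound[of "3 * k + 1" j] by (simp_all add: r_def)
  have t_eq: "t j = (if r j < k then r j else if r j < 2 * k then r j + 2
      else if r j < 3 * k then r j + 4 else 3 * k + 6)" for j
  proof -
    have "r j div k = (if r j < k then 0 else if r j < 2 * k then 1 else if r j < 3 * k then 2 else 3)"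
      using r_bounds[of j] k(1)
        int_div_pos_eq[of "r j" k 0 "r j"] int_div_pos_eq[of "r j" k 1 "r j - k"]
        int_div_pos_eq[of "r j" k 2 "r j - 2 * k"] int_div_pos_eq[of "r j" k 3 "r j - 3 * k"]
      by auto
    then show ?thesis using r_bounds[of j] by (auto simp: t_def)
  qed
  define x where "x = r i"
  have x: "0 \<le> x" "x \<le> 3 * k" unfolding x_def by (rule r_bounds)+
  have shift: "r (i + d) =
       (if x + d < 0 then x + d + (3 * k + 1) else if x + d \<le> 3 * k then x + d else x + d - (3 * k + 1))"
    if "\<bar>d\<bar> \<le> 3 * k" for d
  proof -
    have "r (i + d) = (x + d) mod (3 * k + 1)" by (simp add: x_def r_def mod_add_left_eq)
    also have "\<dots> = (x + d + (3 * k + 1)) mod (3 * k + 1)"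
      "\<dots> = (x + d - (3 * k + 1)) mod (3 * k + 1)"
      by (simp_all only: mod_add_self2 minus_mod_self2)
    ultimately show ?thesis using x that by (smt (verit) mod_pos_pos_trivial)
  qed
  have r_step: "r (i + 1) = (if x = 3 * k then 0 else x + 1)"
      "r (i - 1) = (if x = 0 then 3 * k else x - 1)"
      "r (i + k) = (if x \<le> 2 * k then x + k else x - 2 * k - 1)"
      "r (i - k) = (if x < k then x + 2 * k + 1 else x - k)"
    using x k(1) shift[of 1] shift[of "-1"] shift[of k] shift[of "- k"] by auto
  note t_val = t_eq r_step x_def[symmetric]
  show "?out i \<le> 1" by (rule word_le_1)
  show "?inn i \<le> 1"
  proof (cases "x = k - 1")
    case True
    then have "inner_word (t i) = inner_word 0"
      by (intro word_5(2)[of _ _ m]) (simp add: t_val m)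
    then show ?thesis using True by (simp add: inner_word_def)
  next
    case False
    then show ?thesis using word_le_1[of "t i"] by (simp add: x_def)
  qed
  show "2 \<le> ?out (i - 1) + ?out (i + 1) + ?inn i" if zero: "?out i = 0"
  proof -
    \<comment> \<open>The integers on either side of a jump come first; elsewhere the phase is locally perfect.\<close>
    consider "x = k - 1" | "x = k" | "x = 2 * k - 1" | "x = 2 * k" | "x = 3 * k - 1" | "x = 3 * k"
      | (generic) "x \<notin> {k - 1, k, 2 * k - 1, 2 * k, 3 * k - 1, 3 * k}" by blast
    then show ?thesis
    proof cases
      case 1
      then have "outer_word (t (i - 1)) = outer_word (- 1)"
        using m_pos by (intro word_5[of _ _ m]) (simp add: t_val m)
      moreover have "r i = k - 1" using 1 by (simp add: x_def)
      ultimately show ?thesis by (simp add: outer_word_def)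
    next
      case 2
      then have "outer_word (t (i + 1)) = outer_word 4" "inner_word (t i) = inner_word 3"
        using m_pos by (auto intro!: word_5[of _ _ m] simp: t_val m)
      then show ?thesis by (simp add: outer_word_def inner_word_def)
    next
      case 3
      then have "outer_word (t (i + 1)) = outer_word 1"
        using m_pos by (intro word_5[of _ _ "2 * m + 1"]) (simp add: t_val m)
      moreover have "inner_word (t i) = inner_word 3"
        using 3 m_pos by (intro word_5[of _ _ "2 * m"]) (simp add: t_val m)
      ultimately show ?thesis by (simp add: outer_word_def inner_word_def)
    next
      case 4
      then have "outer_word (t i) = outer_word 1"
        using m_pos by (intro word_5[of _ _ "2 * m + 1"]) (simp add: t_val m)
      with zero show ?thesis by (simp add: outer_word_def)
    next
      case 5
      then have "outer_word (t i) = outer_word 1"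
        using m_pos by (intro word_5[of _ _ "3 * m + 1"]) (simp add: t_val m)
      with zero show ?thesis by (simp add: outer_word_def)
    next
      case 6
      then have "outer_word (t i) = outer_word 4"
        using m_pos by (intro word_5[of _ _ "3 * m + 1"]) (simp add: t_val m)
      with zero show ?thesis by (simp add: outer_word_def)
    next
      case generic
      then have "outer_word (t (i + 1)) = outer_word (t i + 1)"
        using x by (auto simp: t_val)
      moreover have "outer_word (t (i - 1)) = outer_word (t i - 1)"
      proof (cases "x = 0")
        case True
        then show ?thesis using m_pos by (intro word_5[of _ _ "3 * m + 2"]) (simp add: t_val m)
      next
        case False
        then show ?thesis using generic x by (auto simp: t_val)
      qed
      ultimately show ?thesis using outer_word_dominated[OF zero] by simp
    qed
  qed
  show "2 \<le> ?inn (i - k) + ?inn (i + k) + ?out i" if "?inn i = 0"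
  proof -
    have zero: "inner_word (t i) = 0" and not_special: "x \<noteq> k - 1" using that by (auto simp: x_def)
    \<comment> \<open>The bad column step meets the additional label, so an inequality holds without exception.\<close>
    have "inner_word (t (i + k)) = inner_word (t i + 3)" if "x \<noteq> 3 * k"
    proof (cases "x \<le> 2 * k")
      case True
      then show ?thesis
        unfolding t_val using x m_pos by (intro word_5(2)[of _ _ "m"]) (auto simp: m)
    next
      case False
      then show ?thesis
        unfolding t_val using x that m_pos by (intro word_5(2)[of _ _ "- 2 * m - 2"]) (auto simp: m)
    qed
    moreover have "inner_word (t i + 3) \<le> 1" "?inn (i + k) \<ge> 1" if "x = 3 * k"
      using that word_le_1 k(1) by (auto simp: r_step)
    ultimately have "inner_word (t i + 3) \<le> ?inn (i + k)" by (cases "x = 3 * k") auto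
    moreover have "inner_word (t (i - k)) = inner_word (t i - 3)"
    proof (cases "x < k")
      case True
      then show ?thesis
        unfolding t_val using x not_special m_pos by (intro word_5(2)[of _ _ "2 * m + 2"]) (auto simp: m)
    next
      case False
      then show ?thesis
        unfolding t_val using x m_pos by (intro word_5(2)[of _ _ "- m"]) (auto simp: m)
    qed
    ultimately show ?thesis
      using inner_word_dominated[OF zero, of 3] by auto
  qed
qed

text \<open>
  Each of the three rows consists of \<open>m\<close> full periods of the word and one further integer, of phase 0,
  3 and 1 respectively; the integer \<open>3 * k\<close> has phase 4. Phase 0 weighs nothing, the other three phases
  1 each, and so does the additional label.
\<close>

lemma weight_3k_plus_1:
  fixes k m :: nat
  assumes k_def: "k = 5 * m + 1"
  defines "r \<equiv> \<lambda>i. i mod (3 * int k + 1)"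
  defines "t \<equiv> \<lambda>i. r i + 2 * (r i div int k)"
  shows "(\<Sum>i<3 * k + 1. outer_word (t (int i)) + (inner_word (t (int i)) + of_bool (r (int i) = int k - 1)))
           = 12 * m + 4"
proof -
  define h where "h i = word_weight (t (int i))" for i
  have h_row: "h (q * k + x) = word_weight (int (q * k + x) + 2 * int q)"
    if "x < k" "q * k + x < 3 * k + 1" for q x
  proof -
    have "r (int (q * k + x)) = int (q * k + x)"
    proof -
      have "int (q * k + x) < int (3 * k + 1)" using that by (simp only: of_nat_less_iff)
      then show ?thesis unfolding r_def by (intro mod_pos_pos_trivial) simp_all
    qed
    moreover have "int (q * k + x) div int k = int q"
      using that by (intro int_div_pos_eq[where r = "int x"]) auto
    ultimately show ?thesis by (simp add: h_def t_def)
  qed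
  have row: "(\<Sum>x<k. h (q * k + x)) = 4 * m + word_weight (int q * int k + 2 * int q)" if "q < 3" for q
  proof -
    have "q * k + x < 3 * k + 1" if "x < k" for x
      using that \<open>q < 3\<close> mult_le_mono1[of q 2 k] by linarith
    then have "h (q * k + x) = word_weight ((int q * int k + 2 * int q) + int x)" if "x < k" for x
      using that h_row[of x q] by (simp add: ac_simps)
    then have "(\<Sum>x<k. h (q * k + x)) = (\<Sum>x<k. word_weight ((int q * int k + 2 * int q) + int x))"
      by (intro sum.cong) simp_all
    also have "\<dots> = (\<Sum>x<5 * m + 1. word_weight ((int q * int k + 2 * int q) + int x))"
      by (simp only: k_def)
    also have "\<dots> = 4 * m + word_weight ((int q * int k + 2 * int q) + int (5 * m))"
      unfolding sum_lessThan_add word_weight_multiples_5 by simp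
    also have "word_weight ((int q * int k + 2 * int q) + int (5 * m)) = word_weight (int q * int k + 2 * int q)"
      by (simp add: outer_word_def inner_word_def)
    finally show ?thesis .
  qed
  have "(\<Sum>i<3 * k + 1. h i) = (\<Sum>q<3. \<Sum>x<k. h (q * k + x)) + h (3 * k)"
    by (simp add: sum_blocks)
  also have "\<dots> = 12 * m + word_weight 0 + word_weight (int k + 2) + word_weight (2 * int k + 4) + h (3 * k)"
    by (simp add: row eval_nat_numeral)
  also have "h (3 * k) = word_weight (3 * int k + 6)" using h_row[of 0 3] by (simp add: k_def)
  finally have total: "(\<Sum>i<3 * k + 1. h i)
      = 12 * m + word_weight 0 + word_weight (int k + 2) + word_weight (2 * int k + 4)
        + word_weight (3 * int k + 6)" .
  have "(\<Sum>i<3 * k + 1. h i) = 12 * m + 3"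
  proof -
    have "int k + 2 = 3 + 5 * int m" "2 * int k + 4 = 1 + 5 * (2 * int m + 1)"
      "3 * int k + 6 = 4 + 5 * (3 * int m + 1)" by (simp_all add: k_def)
    then show ?thesis unfolding total word_weight_eq by (simp only: mod_mult_self2) simp
  qed
  moreover have "(\<Sum>i<3 * k + 1. of_bool (r (int i) = int k - 1)) = (\<Sum>i<3 * k + 1. of_bool (i = 5 * m) :: nat)"
    by (rule sum.cong) (auto simp: r_def k_def)
  moreover have "\<dots> = 1"
    by (simp add: of_bool_def k_def del: sum_of_bool_eq)
  ultimately show ?thesis by (simp add: h_def sum.distrib add.assoc[symmetric])
qed

section \<open>The bounds\<close>

text \<open>
  The bound on the density is attained for \<open>k \<equiv> 1\<close>. For \<open>k \<equiv> 0, 4\<close> it reads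
  \<open>(4 * k + 1) * (3 * k + 1) \<le> 4 * k * (3 * k + 2)\<close>, that is, \<open>1 \<le> k\<close>.
\<close>

lemma ex_light_helix:
  assumes "4 \<le> k"
  shows "\<exists>out inn N. helix_dominating (int k) out inn \<and> 0 < N \<and>
    (\<forall>i. out (i + int N) = out i) \<and> (\<forall>i. inn (i + int N) = inn i) \<and>
    5 * (3 * k + 1) * (\<Sum>i<N. out (int i) + inn (int i)) \<le> 4 * (3 * k + 2) * N"
proof -
  consider (perfect) "[k = 2] (mod 5) \<or> [k = 3] (mod 5)" | (defect5) "[k = 0] (mod 5) \<or> [k = 4] (mod 5)"
    | (defect3) "[k = 1] (mod 5)"
  proof -
    have "k mod 5 < 5" by simp
    then have "k mod 5 \<in> {0, 1, 2, 3, 4}" by (simp only: insert_iff empty_iff) presburger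
    then show thesis using that by (auto simp: cong_def)
  qed
  then show ?thesis
  proof cases
    case perfect
    then have "[int k = 2] (mod 5) \<or> [int k = 3] (mod 5)" by (metis cong_int_iff of_nat_numeral)
    moreover have "(\<Sum>i<5. word_weight (int i)) = 4"
      using word_weight_5[of 0] by simp
    ultimately show ?thesis
      by (intro exI[of _ outer_word] exI[of _ inner_word] exI[of _ 5])
        (auto simp: helix_dominating_word outer_word_def inner_word_def)
  next
    case defect5
    define t where "t i = i - 2 * (i div int k)" for i
    define out where "out i = outer_word (t i) + of_bool ((i + 1) mod int k = 0 \<and> t i mod 5 = 3)" for i
    define inn where "inn i = inner_word (t i)" for i
    have period: "[t (i + int (5 * k)) = t i] (mod 5)" "(i + int (5 * k) + 1) mod int k = (i + 1) mod int k" for i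
    proof -
      have "(i + int (5 * k)) div int k = i div int k + 5"
        using assms div_mult_self1[of "int k" i 5] by simp
      then have "t (i + int (5 * k)) = t i + 5 * (int k - 2)" by (simp add: t_def)
      then show "[t (i + int (5 * k)) = t i] (mod 5)"
        by (simp only: cong_def mod_mult_self2)
      have "i + int (5 * k) + 1 = i + 1 + 5 * int k" by simp
      then show "(i + int (5 * k) + 1) mod int k = (i + 1) mod int k" by (simp only: mod_mult_self1)
    qed
    have "[int k = 0] (mod 5) \<or> [int k = 4] (mod 5)" using defect5 by (metis cong_int_iff of_nat_numeral of_nat_0)
    then have "helix_dominating (int k) out inn"
      unfolding out_def inn_def t_def using assms by (intro helix_dominating_5k) auto
    moreover have "out (i + int (5 * k)) = out i" "inn (i + int (5 * k)) = inn i" for i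
      using period[of i] word_cong[OF period(1)] by (simp_all add: out_def inn_def cong_def del: of_nat_mult)
    moreover have "(\<Sum>i<5 * k. out (int i) + inn (int i)) = 4 * k + 1"
      unfolding out_def inn_def t_def using weight_5k[OF _ defect5] assms by simp
    ultimately show ?thesis using assms
      by (intro exI[of _ "5 * k"] exI[of _ inn] exI[of _ out]) (simp add: algebra_simps)
  next
    case defect3
    have "k mod 5 = 1" using defect3 by (simp add: cong_def)
    then have m: "k = 5 * (k div 5) + 1" by presburger
    define r where "r i = i mod (3 * int k + 1)" for i
    define t where "t i = r i + 2 * (r i div int k)" for i
    define out where "out i = outer_word (t i)" for i
    define inn where "inn i = inner_word (t i) + of_bool (r i = int k - 1)" for i
    have "[int k = 1] (mod 5)" using defect3 by (metis cong_int_iff of_nat_numeral of_nat_1)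
    then have dom: "helix_dominating (int k) out inn"
      unfolding out_def inn_def t_def r_def using assms by (intro helix_dominating_3k_plus_1) auto
    moreover have "r (i + int (3 * k + 1)) = r i" for i
      by (simp only: r_def of_nat_add of_nat_mult of_nat_numeral of_nat_1 mod_add_self2)
    then have period: "out (i + int (3 * k + 1)) = out i" "inn (i + int (3 * k + 1)) = inn i" for i
      by (simp_all only: out_def inn_def t_def)
    have sum: "(\<Sum>i<3 * k + 1. out (int i) + inn (int i)) = 12 * (k div 5) + 4"
      unfolding out_def inn_def t_def r_def by (rule weight_3k_plus_1[OF m])
    have "5 * (12 * (k div 5) + 4) = 4 * (3 * k + 2)" using m by presburger
    then have "(3 * k + 1) * (5 * (12 * (k div 5) + 4)) = (3 * k + 1) * (4 * (3 * k + 2))"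
      by (simp only:)
    then have light: "5 * (3 * k + 1) * (\<Sum>i<3 * k + 1. out (int i) + inn (int i))
        \<le> 4 * (3 * k + 2) * (3 * k + 1)"
      unfolding sum by (simp only: mult.assoc mult.commute mult.left_commute)
    show ?thesis
      by (rule exI[of _ out], rule exI[of _ inn], rule exI[of _ "3 * k + 1"])
        (use dom period light in \<open>simp del: of_nat_add of_nat_mult\<close>)
  qed
qed

theorem theorem10:
  fixes n k :: nat
  assumes "k \<ge> 4" and "n > 2 * k"
  shows "(([k = 2] (mod 5) \<or> [k = 3] (mod 5)) \<and> [n = 0] (mod 5) \<longrightarrow>
            real (italian_domination_number (gen_petersen n k)) = 4 * real n / 5) \<and>
         (\<not> (([k = 2] (mod 5) \<or> [k = 3] (mod 5)) \<and> [n = 0] (mod 5)) \<longrightarrow>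
            4 * real n / 5 \<le> real (italian_domination_number (gen_petersen n k)) \<and>
            real (italian_domination_number (gen_petersen n k)) \<le>
              4 * (real n - real k) / 5 * ((3 * real k + 2) / (3 * real k + 1))
                + (4 * real k + 6) / 3)"
proof -
  let ?\<gamma> = "italian_domination_number (gen_petersen n k)"
  have k: "1 \<le> k" "2 * k < n" using assms by auto
  have "4 * n \<le> 5 * ?\<gamma>" using k by (rule italian_domination_number_gen_petersen_ge)
  then have lower: "4 * real n / 5 \<le> real ?\<gamma>" by linarith
  have exact: "real ?\<gamma> = 4 * real n / 5"
    if k5: "[k = 2] (mod 5) \<or> [k = 3] (mod 5)" and "[n = 0] (mod 5)"
  proof -
    obtain m where m: "n = 5 * m" using \<open>[n = 0] (mod 5)\<close> by (auto simp: cong_0_iff)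
    have "[int k = 2] (mod 5) \<or> [int k = 3] (mod 5)" using k5 by (metis cong_int_iff of_nat_numeral)
    then have "?\<gamma> \<le> (\<Sum>i<n. word_weight (int i))"
      using k by (intro italian_domination_number_le_helix helix_dominating_word)
        (simp_all add: m outer_word_def inner_word_def)
    also have "\<dots> = 4 * m" using word_weight_multiples_5[of 0 m] by (simp add: m)
    finally show ?thesis using lower m by simp
  qed
  have "real ?\<gamma> \<le> 4 * (real n - real k) / 5 * ((3 * real k + 2) / (3 * real k + 1)) + (4 * real k + 6) / 3"
  proof -
    obtain out inn N where helix: "helix_dominating (int k) out inn" "0 < N"
        "\<And>i. out (i + int N) = out i" "\<And>i. inn (i + int N) = inn i"
      and light: "5 * (3 * k + 1) * (\<Sum>i<N. out (int i) + inn (int i)) \<le> 4 * (3 * k + 2) * N"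
      using ex_light_helix[OF assms(1)] by blast
    define W where "W = (\<Sum>i<N. out (int i) + inn (int i))"
    obtain c where c: "N * (\<Sum>i<n - k. out (c + int i) + inn (c + int i)) \<le> (n - k) * W"
      using ex_light_window[of N "\<lambda>i. out i + inn i" "n - k"] helix unfolding W_def by auto
    define S where "S = (\<Sum>i<n - k. out (c + int i) + inn (c + int i))"
    have "N * (5 * (3 * k + 1) * S) \<le> 5 * (3 * k + 1) * ((n - k) * W)"
      using mult_le_mono2[OF c, of "5 * (3 * k + 1)"] by (simp only: S_def mult.left_commute)
    also have "\<dots> \<le> N * ((n - k) * (4 * (3 * k + 2)))"
      using mult_le_mono2[OF light, of "n - k"] unfolding W_def[symmetric]
      by (simp only: mult.left_commute mult.commute)
    finally have "5 * (3 * k + 1) * S \<le> (n - k) * (4 * (3 * k + 2))"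
      using helix(2) by simp
    then have "real (5 * (3 * k + 1) * S) \<le> real ((n - k) * (4 * (3 * k + 2)))"
      by (simp only: of_nat_le_iff)
    then have "real S \<le> 4 * (real n - real k) / 5 * ((3 * real k + 2) / (3 * real k + 1))"
      using k by (simp add: of_nat_diff field_simps)
    moreover have "3 * ?\<gamma> \<le> 3 * S + 4 * k + 5"
      unfolding S_def using k helix(1) by (rule italian_domination_number_le_window)
    then have "real (3 * ?\<gamma>) \<le> real (3 * S + 4 * k + 5)" by (simp only: of_nat_le_iff)
    then have "real ?\<gamma> \<le> real S + (4 * real k + 6) / 3" by (simp add: field_simps)
    ultimately show ?thesis by linarith
  qed
  with lower exact show ?thesis by blast
qed

end
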